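(* Let $f:\mathbb{R}^n\to\mathbb{R}$ be continuously differentiable on $\mathbb{R}^n$ and bounded below on $\mathbb{R}^n$, and suppose that its gradient $g=\nabla f$ is Lipschitz continuous on $\mathbb{R}^n$, i.e. there is $L>0$ with $\|g(x)-g(y)\|\le L\|x-y\|$ for all $x,y\in\mathbb{R}^n$. Let $\{x_k\}_{k\ge 0}$ be an infinite sequence generated from a starting point $x_0\in\mathbb{R}^n$ by the algorithm GM_AOS (cone) described in the context (with $g(x_k)\neq 0$ for all $k$). Then $$\liminf_{k\to\infty}\|g(x_k)\|=0.$$ Furthermore, if $\eta_{\max}<1$, then $$\lim_{k\to\infty}\|g(x_k)\|=0,$$ and hence every convergent subsequence of $\{x_k\}$ converges to a stationary point $x^*$ of $f$ (i.e. $g(x^* )=0$).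
   Context: Notation: $\|\cdot\|$ is the Euclidean norm, $\|\cdot\|_\infty$ the max norm, $f_k=f(x_k)$, $g_k=g(x_k)=\nabla f(x_k)$, $s_{k-1}=x_k-x_{k-1}$, $y_{k-1}=g_k-g_{k-1}$. Parameters of the algorithm: $0<\lambda_{\min}<\lambda_{\max}$, $0\le\eta_{\min}\le\eta_{\max}\le 1$, $0<\sigma<1$, $\delta>0$, $\xi_1\ge1$, $\xi_2\ge 1$, $\xi_3>0$, $0<\bar\eta<0.1$, $0<c_1<c_2$, and positive numbers $\tau_k>0$. **Algorithm GM_AOS (cone).** Set $Q_0=1$, $C_0=f_0$. (The practical stopping test $\|g_k\|_\infty\le\varepsilon$ is disregarded, so that an infinite sequence is produced.) At iteration $k$: (A) Trial stepsize $\alpha_k^0$. If $k=0$: $\alpha_0^0=1$ if $|f_0|\le10^{-30}$ and $\|x_0\|_\infty\le10^{-30}$; $\alpha_0^0=2|f_0|/\|g_0\|$ if $|f_0|>10^{-30}$ and $\|x_0\|_\infty\le10^{-30}$; $\alpha_0^0=\min\{1,\|x_0\|_\infty/\|g_0\|_\infty\}$ if $\|g_0\|_\infty<10^7$ and $\|x_0\|_\infty>10^{-30}$; $\alpha_0^0=\min\{1,\max\{1,\|x_0\|_\infty\}/\|g_0\|_\infty\}$ if $\|g_0\|_\infty\ge10^7$ and $\|x_0\|_\infty>10^{-30}$. If $k\ge1$: $\alpha_k^0=\max\{\min\{\hat\alpha_k,\lambda_{\max}\},\lambda_{\min}\}$, where $\hat\alpha_k$ is defined as follows. Let $\alpha_k^{BB_1}=\|s_{k-1}\|^2/(s_{k-1}^Ty_{k-1})$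 and $\alpha_k^{BB_2}=s_{k-1}^Ty_{k-1}/\|y_{k-1}\|^2$, and $$\mu_k=\left|\frac{2(f_{k-1}-f_k+g_k^Ts_{k-1})}{s_{k-1}^Ty_{k-1}}-1\right|.$$ Condition (Q): $\mu_k\le c_1$ or $\max\{\mu_k,\mu_{k-1}\}\le c_2$. Conic quantities: $\Delta_k=(f_{k-1}-f_k)^2-(g_k^Ts_{k-1})(g_{k-1}^Ts_{k-1})$; when $\Delta_k>0$, $\rho_k=\sqrt{\Delta_k}$, $\gamma_k=\max\{\min\{\frac{-g_{k-1}^Ts_{k-1}}{\rho_k+f_{k-1}-f_k},2\},0.01\}$, $b_k=\max\{\min\{\frac{1-\gamma_k}{\gamma_kg_{k-1}^Ts_{k-1}},5000\},-5000\}\,g_{k-1}$, $v_{k-1}=\gamma_ks_{k-1}$, $r_{k-1}=\frac1{\gamma_k}\left(\gamma_kg_k-\frac1{\gamma_k}g_{k-1}\right)$; when moreover $v_{k-1}^Tr_{k-1}>0$, $D_k=\xi_1\frac{v_{k-1}^Tv_{k-1}}{v_{k-1}^Tr_{k-1}}I$ and $$B_k=D_k-\frac{D_kv_{k-1}v_{k-1}^TD_k}{v_{k-1}^TD_kv_{k-1}}+\frac{r_{k-1}r_{k-1}^T}{v_{k-1}^Tr_{k-1}}.$$ Condition (C): $\Delta_k>0$, $v_{k-1}^Tr_{k-1}>0$ and $g_k^TB_kg_k+(g_k^Tg_k)(b_k^Tg_k)>0$. Convention: a condition (or alternative in a condition) involving an undefined quantity (zero denominator, or $\mu_0$) is regarded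 as not holding. - Case 1: (Q) does not hold and (C) holds. Put $\alpha_k^S=\dfrac{g_k^Tg_k}{g_k^TB_kg_k+(g_k^Tg_k)(b_k^Tg_k)}$. Then $\hat\alpha_k=\max\{\min\{\alpha_k^S,\alpha_k^{BB_1}\},\alpha_k^{BB_2}\}$ if $s_{k-1}^Ty_{k-1}>0$, and $\hat\alpha_k=\alpha_k^S$ otherwise. - Case 2: Case 1 does not apply and $s_{k-1}^Ty_{k-1}>0$. Put $\bar r_k=\min\{\max\{3(g_k+g_{k-1})^Ts_{k-1}+6(f_{k-1}-f_k),-\bar\eta s_{k-1}^Ty_{k-1}\},\bar\eta s_{k-1}^Ty_{k-1}\}$, $\tilde y_{k-1}=y_{k-1}+\frac{\bar r_k}{\|s_{k-1}\|^2}s_{k-1}$, $\tilde D_k=\xi_2\frac{y_{k-1}^Ty_{k-1}}{s_{k-1}^Ty_{k-1}}I$, $\tilde B_k=\tilde D_k-\frac{\tilde D_ks_{k-1}s_{k-1}^T\tilde D_k}{s_{k-1}^T\tilde D_ks_{k-1}}+\frac{\tilde y_{k-1}\tilde y_{k-1}^T}{s_{k-1}^T\tilde y_{k-1}}$. Then $\hat\alpha_k=\max\left\{\min\left\{\frac{g_k^Tg_k}{g_k^T\tilde B_kg_k},\alpha_k^{BB_1}\right\},\alpha_k^{BB_2}\right\}$. - Case 3: Case 1 does not apply and $s_{k-1}^Ty_{k-1}\le0$. Put $h_k=g_k^T\big(g(x_k-\tau_kg_k)-g(x_k)\big)/\tau_k$. Then $\hat\alpha_k=\frac{g_k^Tg_k}{|h_k|}$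 if $\frac{\|g_{k-1}\|^2}{\|g_k\|^2}<\xi_3$ and $h_k\ne0$; $\hat\alpha_k=\frac{\|g_k\|^2}{|s_{k-1}^Ty_{k-1}|}\alpha_{k-1}^2$ if $\frac{\|g_{k-1}\|^2}{\|g_k\|^2}\ge\xi_3$ and $s_{k-1}^Ty_{k-1}\ne0$; $\hat\alpha_k=\delta\alpha_{k-1}$ otherwise. (B) Nonmonotone (Zhang–Hager) line search. Start with $\alpha=\alpha_k^0$. While $f(x_k-\alpha g_k)\le C_k-\sigma\alpha\|g_k\|^2$ fails, replace $\alpha$ by $\bar\alpha$ if $\alpha>0.1\alpha_k^0$ and $\bar\alpha\in[0.1\alpha_k^0,0.9\alpha]$, and by $0.5\alpha$ otherwise, where $\bar\alpha$ is the minimizer of the quadratic $q$ with $q(0)=f_k$, $q'(0)=-\|g_k\|^2$, $q(\alpha)=f(x_k-\alpha g_k)$. When the inequality holds, set $\alpha_k=\alpha$ and $x_{k+1}=x_k-\alpha_kg_k$. (C') Choose $\eta_k\in[\eta_{\min},\eta_{\max}]$ and set $Q_{k+1}=\eta_kQ_k+1$, $C_{k+1}=(\eta_kQ_kC_k+f(x_{k+1}))/Q_{k+1}$. *)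

theory Defs
  imports
    "HOL-Analysis.Analysis"
    "HOL-Computational_Algebra.Polynomial"
    "HOL-Library.While_Combinator"
begin

record gm_aos_params =
  lam_min :: real
  lam_max :: real
  eta_min :: real
  eta_max :: real
  sigma :: real
  delta :: real
  xi1 :: real
  xi2 :: real
  xi3 :: real
  eta_bar :: real
  c1 :: real
  c2 :: real
  tau :: "nat \<Rightarrow> real"

definition valid_params :: "gm_aos_params \<Rightarrow> bool" where
  "valid_params P \<longleftrightarrow>
     0 < lam_min P \<and> lam_min P < lam_max P \<and>
     0 \<le> eta_min P \<and> eta_min P \<le> eta_max P \<and> eta_max P \<le> 1 \<and>
     0 < sigma P \<and> sigma P < 1 \<and>
     0 < delta P \<and>
     1 \<le> xi1 P \<and> 1 \<le> xi2 P \<and> 0 < xi3 P \<and>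
     0 < eta_bar P \<and> eta_bar P < 0.1 \<and>
     0 < c1 P \<and> c1 P < c2 P \<and>
     (\<forall>k. 0 < tau P k)"

definition outer :: "real ^ 'n \<Rightarrow> real ^ 'n \<Rightarrow> real ^ 'n ^ 'n" where
  "outer u w = (\<chi> i j. u $ i * w $ j)"

text \<open>BFGS update of \<open>D\<close> along the step \<open>u\<close> with gradient difference \<open>w\<close>.\<close>

definition bfgs :: "real ^ 'n ^ 'n \<Rightarrow> real ^ 'n \<Rightarrow> real ^ 'n \<Rightarrow> real ^ 'n ^ 'n" where
  "bfgs D u w =
     D - (1 / (u \<bullet> (D *v u))) *\<^sub>R (D ** outer u u ** D) + (1 / (u \<bullet> w)) *\<^sub>R outer w w"

text \<open>
  Indices follow the mathematical ones: iteration \<open>k\<close> uses \<open>s (k - 1)\<close>, which is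
  \<open>s\<close> with index \<open>k - 1\<close>. Where \<open>k - 1\<close> occurs, only the values for
  \<open>k \<ge> 1\<close> are ever used. The sequence \<open>a\<close> consists of the accepted stepsizes and
  \<open>C\<close> of the reference values of the nonmonotone line search.
\<close>

locale gm_aos =
  fixes P :: gm_aos_params
    and f :: "real ^ 'n \<Rightarrow> real"
    and g :: "real ^ 'n \<Rightarrow> real ^ 'n"
    and x :: "nat \<Rightarrow> real ^ 'n"
    and a :: "nat \<Rightarrow> real"
    and C :: "nat \<Rightarrow> real"
begin

abbreviation F :: "nat \<Rightarrow> real" where "F k \<equiv> f (x k)"
abbreviation G :: "nat \<Rightarrow> real ^ 'n" where "G k \<equiv> g (x k)"

definition s :: "nat \<Rightarrow> real ^ 'n" where
  "s j = x (Suc j) - x j"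

definition y :: "nat \<Rightarrow> real ^ 'n" where
  "y j = G (Suc j) - G j"

definition BB1 :: "nat \<Rightarrow> real" where
  "BB1 k = (norm (s (k - 1)))\<^sup>2 / (s (k - 1) \<bullet> y (k - 1))"

definition BB2 :: "nat \<Rightarrow> real" where
  "BB2 k = (s (k - 1) \<bullet> y (k - 1)) / (norm (y (k - 1)))\<^sup>2"

text \<open>\<open>None\<close> stands for undefined.\<close>

definition mu :: "nat \<Rightarrow> real option" where
  "mu k =
     (if k = 0 \<or> s (k - 1) \<bullet> y (k - 1) = 0 then None
      else Some \<bar>2 * (F (k - 1) - F k + G k \<bullet> s (k - 1)) / (s (k - 1) \<bullet> y (k - 1)) - 1\<bar>)"

definition cond_Q :: "nat \<Rightarrow> bool" where
  "cond_Q k \<longleftrightarrow>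
     (\<exists>m. mu k = Some m \<and> m \<le> c1 P) \<or>
     (\<exists>m m'. mu k = Some m \<and> mu (k - 1) = Some m' \<and> max m m' \<le> c2 P)"

definition Delta :: "nat \<Rightarrow> real" where
  "Delta k = (F (k - 1) - F k)\<^sup>2 - (G k \<bullet> s (k - 1)) * (G (k - 1) \<bullet> s (k - 1))"

definition rho :: "nat \<Rightarrow> real" where
  "rho k = sqrt (Delta k)"

definition gam :: "nat \<Rightarrow> real" where
  "gam k = max (min (- (G (k - 1) \<bullet> s (k - 1)) / (rho k + F (k - 1) - F k)) 2) 0.01"

definition b :: "nat \<Rightarrow> real ^ 'n" where
  "b k = max (min ((1 - gam k) / (gam k * (G (k - 1) \<bullet> s (k - 1)))) 5000) (- 5000) *\<^sub>R G (k - 1)"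

definition v :: "nat \<Rightarrow> real ^ 'n" where
  "v j = gam (Suc j) *\<^sub>R s j"

definition r :: "nat \<Rightarrow> real ^ 'n" where
  "r j = (1 / gam (Suc j)) *\<^sub>R (gam (Suc j) *\<^sub>R G (Suc j) - (1 / gam (Suc j)) *\<^sub>R G j)"

definition D :: "nat \<Rightarrow> real ^ 'n ^ 'n" where
  "D k = mat (xi1 P * (v (k - 1) \<bullet> v (k - 1)) / (v (k - 1) \<bullet> r (k - 1)))"

definition B :: "nat \<Rightarrow> real ^ 'n ^ 'n" where
  "B k = bfgs (D k) (v (k - 1)) (r (k - 1))"

text \<open>
  The three conditions with \<open>\<noteq> 0\<close> say that \<open>gam k\<close>, \<open>b k\<close> and \<open>B k\<close> are defined.
\<close>

definition cond_C :: "nat \<Rightarrow> bool" where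
  "cond_C k \<longleftrightarrow>
     Delta k > 0 \<and>
     rho k + F (k - 1) - F k \<noteq> 0 \<and>
     gam k * (G (k - 1) \<bullet> s (k - 1)) \<noteq> 0 \<and>
     v (k - 1) \<bullet> r (k - 1) > 0 \<and>
     v (k - 1) \<bullet> (D k *v v (k - 1)) \<noteq> 0 \<and>
     G k \<bullet> (B k *v G k) + (G k \<bullet> G k) * (b k \<bullet> G k) > 0"

definition alpha_S :: "nat \<Rightarrow> real" where
  "alpha_S k = (G k \<bullet> G k) / (G k \<bullet> (B k *v G k) + (G k \<bullet> G k) * (b k \<bullet> G k))"

definition r_bar :: "nat \<Rightarrow> real" where
  "r_bar k =
     min (max (3 * ((G k + G (k - 1)) \<bullet> s (k - 1)) + 6 * (F (k - 1) - F k))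
              (- eta_bar P * (s (k - 1) \<bullet> y (k - 1))))
         (eta_bar P * (s (k - 1) \<bullet> y (k - 1)))"

definition y_til :: "nat \<Rightarrow> real ^ 'n" where
  "y_til j = y j + (r_bar (Suc j) / (norm (s j))\<^sup>2) *\<^sub>R s j"

definition D_til :: "nat \<Rightarrow> real ^ 'n ^ 'n" where
  "D_til k = mat (xi2 P * (y (k - 1) \<bullet> y (k - 1)) / (s (k - 1) \<bullet> y (k - 1)))"

definition B_til :: "nat \<Rightarrow> real ^ 'n ^ 'n" where
  "B_til k = bfgs (D_til k) (s (k - 1)) (y_til (k - 1))"

definition h :: "nat \<Rightarrow> real" where
  "h k = (G k \<bullet> (g (x k - tau P k *\<^sub>R G k) - g (x k))) / tau P k"

definition alpha_hat :: "nat \<Rightarrow> real" where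
  "alpha_hat k =
     (if \<not> cond_Q k \<and> cond_C k then
        (if s (k - 1) \<bullet> y (k - 1) > 0 then max (min (alpha_S k) (BB1 k)) (BB2 k)
         else alpha_S k)
      else if s (k - 1) \<bullet> y (k - 1) > 0 then
        max (min ((G k \<bullet> G k) / (G k \<bullet> (B_til k *v G k))) (BB1 k)) (BB2 k)
      else if (norm (G (k - 1)))\<^sup>2 / (norm (G k))\<^sup>2 < xi3 P \<and> h k \<noteq> 0 then
        (G k \<bullet> G k) / \<bar>h k\<bar>
      else if (norm (G (k - 1)))\<^sup>2 / (norm (G k))\<^sup>2 \<ge> xi3 P \<and> s (k - 1) \<bullet> y (k - 1) \<noteq> 0 then
        (norm (G k))\<^sup>2 / \<bar>s (k - 1) \<bullet> y (k - 1)\<bar> * (a (k - 1))\<^sup>2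
      else delta P * a (k - 1))"

definition alpha_init :: real where
  "alpha_init =
     (if infnorm (x 0) \<le> 1 / 10 ^ 30 then
        (if \<bar>F 0\<bar> \<le> 1 / 10 ^ 30 then 1 else 2 * \<bar>F 0\<bar> / norm (G 0))
      else if infnorm (G 0) < 10 ^ 7 then min 1 (infnorm (x 0) / infnorm (G 0))
      else min 1 (max 1 (infnorm (x 0)) / infnorm (G 0)))"

definition trial :: "nat \<Rightarrow> real" where
  "trial k = (if k = 0 then alpha_init else max (min (alpha_hat k) (lam_max P)) (lam_min P))"

definition acceptable :: "nat \<Rightarrow> real \<Rightarrow> bool" where
  "acceptable k t \<longleftrightarrow> f (x k - t *\<^sub>R G k) \<le> C k - sigma P * t * (norm (G k))\<^sup>2"

definition interpolation_minimizer :: "nat \<Rightarrow> real \<Rightarrow> real \<Rightarrow> bool" where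
  "interpolation_minimizer k t u \<longleftrightarrow>
     (\<exists>q :: real poly. degree q \<le> 2 \<and> poly q 0 = F k \<and>
        poly (pderiv q) 0 = - (norm (G k))\<^sup>2 \<and> poly q t = f (x k - t *\<^sub>R G k) \<and>
        is_arg_min (poly q) (\<lambda>_. True) u)"

text \<open>If the interpolating quadratic has no minimizer, the stepsize is halved.\<close>

definition backtrack :: "nat \<Rightarrow> real \<Rightarrow> real" where
  "backtrack k t =
     (if t > 0.1 * trial k \<and>
         (\<exists>u. interpolation_minimizer k t u \<and> u \<in> {0.1 * trial k .. 0.9 * t})
      then (THE u. interpolation_minimizer k t u)
      else 0.5 * t)"

text \<open>
  The equation with \<open>Some\<close> says that the line search started at \<open>trial k\<close> terminates,
  with result \<open>a k\<close>.
\<close>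

definition run :: "(nat \<Rightarrow> real) \<Rightarrow> (nat \<Rightarrow> real) \<Rightarrow> bool" where
  "run Q \<eta> \<longleftrightarrow>
     Q 0 = 1 \<and> C 0 = F 0 \<and>
     (\<forall>k. while_option (\<lambda>t. \<not> acceptable k t) (backtrack k) (trial k) = Some (a k) \<and>
          x (Suc k) = x k - a k *\<^sub>R G k \<and>
          \<eta> k \<in> {eta_min P .. eta_max P} \<and>
          Q (Suc k) = \<eta> k * Q k + 1 \<and>
          C (Suc k) = (\<eta> k * Q k * C k + F (Suc k)) / Q (Suc k))"

end

end

theory Submission
  imports Defs
begin

text \<open>
  By the descent lemma, the line search accepts every step below \<open>2 (1 - \<sigma>) / L\<close>, and one
  backtracking step shrinks the stepsize at most by a factor 10. As the trial stepsizes are, from \<open>k = 1\<close> on,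
  at least \<open>\<lambda>\<^sub>m\<^sub>i\<^sub>n\<close>, the accepted ones are bounded away from 0, whatever the case distinction
  in the choice of the trial stepsize. The reference values satisfy
  \<open>C\<^sub>k - C\<^sub>k\<^sub>+\<^sub>1 = (C\<^sub>k - f\<^sub>k\<^sub>+\<^sub>1) / Q\<^sub>k\<^sub>+\<^sub>1\<close>, so that \<open>\<Sum> \<parallel>g\<^sub>k\<parallel>\<^sup>2 / Q\<^sub>k\<^sub>+\<^sub>1\<close> converges. Now \<open>Q\<^sub>k \<le> k + 1\<close>
  and divergence of the harmonic series give the first claim. If \<open>\<eta>\<^sub>m\<^sub>a\<^sub>x < 1\<close>, then \<open>Q\<close> is
  bounded and \<open>\<Sum> \<parallel>g\<^sub>k\<parallel>\<^sup>2\<close> itself converges.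
\<close>

section \<open>Analytic preliminaries: descent, quadratic interpolation, telescoping\<close>

lemma descent_lemma:
  fixes f :: "'a::real_inner \<Rightarrow> real"
  assumes grad: "\<And>z. GDERIV f z :> g z"
    and lip: "\<And>z w. norm (g z - g w) \<le> L * norm (z - w)"
  shows "f (z + d) \<le> f z + g z \<bullet> d + L / 2 * (norm d)\<^sup>2"
proof -
  \<comment> \<open>The claim is \<open>\<psi> 1 \<le> \<psi> 0\<close>. The quadratic term is
    chosen so that its derivative matches the Lipschitz bound on the change of the slope along the
    segment.\<close>
  define \<psi> where "\<psi> t = f (z + t *\<^sub>R d) - t * (g z \<bullet> d) - L / 2 * t\<^sup>2 * (norm d)\<^sup>2" for t
  have "\<psi> 1 \<le> \<psi> 0"
  proof (rule DERIV_nonpos_imp_nonincreasing[where f = \<psi> and a = 0 and b = 1])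
    fix t :: real
    assume t: "0 \<le> t" "t \<le> 1"
    have "(f has_derivative (\<lambda>h. h \<bullet> g (z + t *\<^sub>R d))) (at (z + t *\<^sub>R d))"
      using grad by (simp add: gderiv_def)
    then have "((\<lambda>t. f (z + t *\<^sub>R d)) has_derivative (\<lambda>u. (u *\<^sub>R d) \<bullet> g (z + t *\<^sub>R d))) (at t)"
      by (rule has_derivative_compose[rotated]) (auto intro!: derivative_eq_intros)
    then have "((\<lambda>t. f (z + t *\<^sub>R d)) has_real_derivative g (z + t *\<^sub>R d) \<bullet> d) (at t)"
      by (simp add: has_field_derivative_def inner_commute mult_commute_abs)
    then have "(\<psi> has_real_derivative
        g (z + t *\<^sub>R d) \<bullet> d - g z \<bullet> d - L * t * (norm d)\<^sup>2) (at t)"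
      unfolding \<psi>_def by (auto intro!: derivative_eq_intros)
    moreover have "(g (z + t *\<^sub>R d) - g z) \<bullet> d \<le> L * t * (norm d)\<^sup>2"
    proof -
      have "(g (z + t *\<^sub>R d) - g z) \<bullet> d \<le> norm (g (z + t *\<^sub>R d) - g z) * norm d"
        by (rule norm_cauchy_schwarz)
      also have "\<dots> \<le> (L * norm (t *\<^sub>R d)) * norm d"
        using lip[of "z + t *\<^sub>R d" z] by (intro mult_right_mono) auto
      finally show ?thesis
        using t by (simp add: power2_eq_square mult_ac)
    qed
    ultimately show "\<exists>y. (\<psi> has_real_derivative y) (at t) \<and> y \<le> 0"
      by (auto simp: inner_diff_left)
  qed simp
  then show ?thesis
    by (simp add: \<psi>_def)
qed

text \<open>The three interpolation data fix all coefficients. A minimizer is stationary, so the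
  nonzero slope at 0 forces a nonzero leading coefficient and hence a single stationary point. This
  gives meaning to the \<open>THE\<close> in \<open>backtrack\<close>.\<close>

lemma quadratic_interpolation_argmin_unique:
  fixes p q :: "real poly"
  assumes deg: "degree p \<le> 2" "degree q \<le> 2"
    and val: "poly p 0 = poly q 0" "poly p t = poly q t" "t \<noteq> 0"
    and slope: "poly (pderiv p) 0 = poly (pderiv q) 0" "poly (pderiv q) 0 \<noteq> 0"
    and min: "is_arg_min (poly p) (\<lambda>_. True) u" "is_arg_min (poly q) (\<lambda>_. True) w"
  shows "u = w"
proof -
  have rep: "poly r z = poly r 0 + poly (pderiv r) 0 * z + coeff r 2 * z\<^sup>2"
    if "degree r \<le> 2" for r :: "real poly" and z
  proof -
    have "poly r z = (\<Sum>i\<le>2. coeff r i * z ^ i)"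
      unfolding poly_altdef using that
      by (intro sum.mono_neutral_left) (auto simp: coeff_eq_0)
    then show ?thesis
      by (simp add: poly_0_coeff_0 coeff_pderiv numeral_2_eq_2)
  qed
  have stationary: "poly (pderiv r) 0 + 2 * coeff r 2 * z = 0"
    if "degree r \<le> 2" "is_arg_min (poly r) (\<lambda>_. True) z" for r :: "real poly" and z
  proof -
    have "poly r = (\<lambda>z. poly r 0 + poly (pderiv r) 0 * z + coeff r 2 * z\<^sup>2)"
      using rep[OF that(1)] by blast
    then have "(poly r has_real_derivative poly (pderiv r) 0 + 2 * coeff r 2 * z) (at z)"
      by (rule ssubst) (auto intro!: derivative_eq_intros)
    then show ?thesis
      by (rule DERIV_local_min[where d = 1]) (use that(2) in \<open>auto simp: is_arg_min_linorder\<close>)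
  qed
  have "coeff p 2 = coeff q 2"
    using rep[OF deg(1), of t] rep[OF deg(2), of t] val slope by simp
  then have u: "poly (pderiv q) 0 + 2 * coeff q 2 * u = 0"
    using stationary[OF deg(1) min(1)] slope(1) by simp
  have w: "poly (pderiv q) 0 + 2 * coeff q 2 * w = 0"
    using stationary[OF deg(2) min(2)] .
  from u slope(2) have "coeff q 2 \<noteq> 0"
    by auto
  moreover from u w have "2 * coeff q 2 * u = 2 * coeff q 2 * w"
    by linarith
  ultimately show ?thesis
    by simp
qed

lemma summable_of_decrease:
  fixes d c :: "nat \<Rightarrow> real"
  assumes "\<And>k. 0 \<le> d k" "\<And>k. d k \<le> c k - c (Suc k)" "\<And>k. m \<le> c k"
  shows "summable d"
proof (rule bounded_imp_summable)
  fix n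
  have "(\<Sum>k\<le>n. d k) \<le> (\<Sum>k\<le>n. c k - c (Suc k))"
    by (intro sum_mono assms)
  also have "\<dots> = c 0 - c (Suc n)"
    by (rule sum_telescope)
  also have "\<dots> \<le> c 0 - m"
    using assms(3) by simp
  finally show "(\<Sum>k\<le>n. d k) \<le> c 0 - m" .
qed (rule assms)

section \<open>Line search: accepted stepsizes from below\<close>

context gm_aos
begin

lemma interpolation_minimizer_unique:
  assumes "interpolation_minimizer k t u" "interpolation_minimizer k t w"
    and "t \<noteq> 0" "G k \<noteq> 0"
  shows "u = w"
proof -
  obtain p q :: "real poly" where
      "degree p \<le> 2" "poly p 0 = F k" "poly (pderiv p) 0 = - (norm (G k))\<^sup>2"
      "poly p t = f (x k - t *\<^sub>R G k)" "is_arg_min (poly p) (\<lambda>_. True) u"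
      "degree q \<le> 2" "poly q 0 = F k" "poly (pderiv q) 0 = - (norm (G k))\<^sup>2"
      "poly q t = f (x k - t *\<^sub>R G k)" "is_arg_min (poly q) (\<lambda>_. True) w"
    using assms(1,2) unfolding interpolation_minimizer_def by blast
  then show ?thesis
    using assms(3,4) by - (rule quadratic_interpolation_argmin_unique[of p q t], auto)
qed

text \<open>An interpolated step is at least \<open>0.1 * trial k\<close>, which dominates
  \<open>0.1 * t\<close> because \<open>t\<close> never exceeds the trial step.\<close>

lemma backtrack_bounds:
  assumes "0 < t" "t \<le> trial k" "G k \<noteq> 0"
  shows "0.1 * t \<le> backtrack k t" "backtrack k t \<le> t"
proof -
  have "0.1 * t \<le> backtrack k t \<and> backtrack k t \<le> t"
  proof (cases "t > 0.1 * trial k \<and>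
      (\<exists>u. interpolation_minimizer k t u \<and> u \<in> {0.1 * trial k .. 0.9 * t})")
    case True
    then obtain u where u: "interpolation_minimizer k t u" "u \<in> {0.1 * trial k .. 0.9 * t}"
      by blast
    then have "(THE w. interpolation_minimizer k t w) = u"
      using assms by (blast intro: interpolation_minimizer_unique)
    then have "backtrack k t = u"
      using True by (simp only: backtrack_def if_True simp_thms)
    then show ?thesis
      using u(2) assms by auto
  next
    case False
    then have "backtrack k t = 0.5 * t"
      by (simp only: backtrack_def if_False)
    then show ?thesis
      using assms by simp
  qed
  then show "0.1 * t \<le> backtrack k t" "backtrack k t \<le> t"
    by auto
qed

lemma line_search_stepsize_ge:
  assumes while: "while_option (\<lambda>t. \<not> acceptable k t) (backtrack k) (trial k) = Some t"
    and short: "\<And>t. 0 < t \<Longrightarrow> t \<le> m \<Longrightarrow> acceptable k t"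
    and pos: "0 < trial k" "0 < m" and "G k \<noteq> 0"
  shows "min (trial k) (0.1 * m) \<le> t"
proof -
  \<comment> \<open>Loop invariant: a rejected step exceeds \<open>m\<close>, so its successor is at
    least \<open>0.1 * m\<close>. The upper bound is carried along for
    \<open>backtrack_bounds\<close>.\<close>
  have "min (trial k) (0.1 * m) \<le> t \<and> t \<le> trial k"
  proof (rule while_option_rule[OF _ while])
    fix t
    assume t: "min (trial k) (0.1 * m) \<le> t \<and> t \<le> trial k" and "\<not> acceptable k t"
    moreover from t pos have "0 < t"
      by auto
    ultimately have "m < t"
      using short by force
    then show "min (trial k) (0.1 * m) \<le> backtrack k t \<and> backtrack k t \<le> trial k"
      using backtrack_bounds[OF \<open>0 < t\<close>, of k] t \<open>G k \<noteq> 0\<close> by auto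
  qed simp
  then show ?thesis ..
qed

lemma trial_pos:
  assumes "valid_params P" "\<And>k. G k \<noteq> 0"
  shows "0 < trial k"
proof (cases "k = 0")
  case True
  have "0 < infnorm (G 0)"
    using assms(2) by (simp add: infnorm_pos_lt)
  then show ?thesis
    \<comment> \<open>The thresholds of the initial rule make the numerators strictly
      positive.\<close>
    using True assms(2)[of 0] less_trans[of 0 "1 / 10 ^ 30" "infnorm (x 0)"]
      less_trans[of 0 "1 / 10 ^ 30" "\<bar>F 0\<bar>"]
    by (simp add: trial_def alpha_init_def)
next
  case False
  then show ?thesis
    using assms(1) by (auto simp: trial_def valid_params_def)
qed

text \<open>Along the negative gradient, the descent lemma guarantees a decrease with factor
  \<open>1 - L * t / 2\<close>, which is at least \<open>sigma P\<close> exactly in the given range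
  of \<open>t\<close>.\<close>

lemma short_step_acceptable:
  assumes grad: "\<And>z. GDERIV f z :> g z"
    and lip: "\<And>z w. norm (g z - g w) \<le> L * norm (z - w)"
    and "L > 0" "F k \<le> C k" "0 < t" "t \<le> 2 * (1 - sigma P) / L"
  shows "acceptable k t"
proof -
  have "f (x k - t *\<^sub>R G k) \<le> F k - t * (norm (G k))\<^sup>2 + L / 2 * t\<^sup>2 * (norm (G k))\<^sup>2"
    using descent_lemma[OF grad lip, of "x k" "- (t *\<^sub>R G k)"]
    by (simp add: power_mult_distrib power2_norm_eq_inner)
  also have "\<dots> = F k - t * (1 - L * t / 2) * (norm (G k))\<^sup>2"
    by (simp add: algebra_simps power2_eq_square)
  also have "\<dots> \<le> C k - t * sigma P * (norm (G k))\<^sup>2"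
  proof -
    have "sigma P \<le> 1 - L * t / 2"
      using assms by (simp add: field_simps)
    then have "t * sigma P * (norm (G k))\<^sup>2 \<le> t * (1 - L * t / 2) * (norm (G k))\<^sup>2"
      using \<open>0 < t\<close> by (intro mult_right_mono mult_left_mono) auto
    then show ?thesis
      using \<open>F k \<le> C k\<close> by simp
  qed
  finally show ?thesis
    by (simp add: acceptable_def mult_ac)
qed

end

section \<open>Runs of the algorithm: weights and reference values\<close>

locale gm_aos_run = gm_aos P f g x a C
  for P :: gm_aos_params
    and f :: "real ^ 'n \<Rightarrow> real"
    and g :: "real ^ 'n \<Rightarrow> real ^ 'n"
    and x :: "nat \<Rightarrow> real ^ 'n"
    and a C :: "nat \<Rightarrow> real" +
  fixes L :: real
    and Q \<eta> :: "nat \<Rightarrow> real"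
  assumes params: "valid_params P"
    and gradient: "\<And>z. GDERIV f z :> g z"
    and bounded_below: "bdd_below (range f)"
    and L_pos: "L > 0"
    and gradient_lipschitz: "\<And>z w. norm (g z - g w) \<le> L * norm (z - w)"
    and run: "run Q \<eta>"
    and nonstationary: "\<And>k. G k \<noteq> 0"
begin

lemma while: "while_option (\<lambda>t. \<not> acceptable k t) (backtrack k) (trial k) = Some (a k)"
  and x_Suc: "x (Suc k) = x k - a k *\<^sub>R G k"
  and eta: "0 \<le> \<eta> k" "\<eta> k \<le> eta_max P" "\<eta> k \<le> 1"
  and Q_Suc: "Q (Suc k) = \<eta> k * Q k + 1"
  and C_Suc: "C (Suc k) = (\<eta> k * Q k * C k + F (Suc k)) / Q (Suc k)"
  using run params by (auto simp: run_def valid_params_def dest!: spec[of _ k])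

lemma Q_ge_1: "1 \<le> Q k"
proof (induction k)
  case 0
  then show ?case
    using run by (simp add: run_def)
next
  case (Suc k)
  then show ?case
    using eta[of k] by (simp add: Q_Suc)
qed

lemma Q_le_linear: "Q k \<le> real k + 1"
proof (induction k)
  case 0
  then show ?case
    using run by (simp add: run_def)
next
  case (Suc k)
  have "\<eta> k * Q k \<le> 1 * Q k"
    using eta[of k] Q_ge_1[of k] by (intro mult_right_mono) auto
  with Suc show ?case
    by (simp add: Q_Suc)
qed

text \<open>The bound is the fixed point of the map sending \<open>q\<close> to
  \<open>eta_max P * q + 1\<close>, and it is at least the initial value 1.\<close>

lemma Q_le_const:
  assumes "eta_max P < 1"
  shows "Q k \<le> 1 / (1 - eta_max P)"
proof (induction k)
  case 0
  have "0 \<le> eta_max P"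
    using params by (simp add: valid_params_def)
  with assms run show ?case
    by (simp add: run_def field_simps)
next
  case (Suc k)
  have "\<eta> k * Q k \<le> eta_max P * (1 / (1 - eta_max P))"
    using eta[of k] Q_ge_1[of k] Suc by (intro mult_mono) auto
  with assms show ?case
    by (simp add: Q_Suc field_simps)
qed

lemma Armijo: "F (Suc k) \<le> C k - sigma P * a k * (norm (G k))\<^sup>2"
  using while_option_stop[OF while[of k]] by (simp add: acceptable_def x_Suc)

text \<open>The premise is kept explicit because its own inductive proof, in \<open>F_le_C\<close>,
  needs the positivity of the current stepsize.\<close>

lemma stepsize_ge_of_F_le_C:
  assumes "F k \<le> C k"
  shows "min (trial k) (0.1 * (2 * (1 - sigma P) / L)) \<le> a k"
proof -
  have "0 < 2 * (1 - sigma P) / L"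
    using params L_pos by (simp add: valid_params_def)
  then show ?thesis
    using trial_pos[OF params] nonstationary
      short_step_acceptable[OF gradient gradient_lipschitz L_pos assms]
    by (intro line_search_stepsize_ge[OF while]) auto
qed

lemma stepsize_pos_of_F_le_C:
  assumes "F k \<le> C k"
  shows "0 < a k"
proof -
  have "0 < min (trial k) (0.1 * (2 * (1 - sigma P) / L))"
    using trial_pos[OF params nonstationary] params L_pos by (simp add: valid_params_def)
  then show ?thesis
    using stepsize_ge_of_F_le_C[OF assms] by linarith
qed

text \<open>\<open>C (Suc k)\<close> is a convex combination of \<open>C k\<close> and
  \<open>F (Suc k)\<close>, and the Armijo inequality makes \<open>F (Suc k)\<close> the smaller of
  the two.\<close>

lemma F_le_C: "F k \<le> C k"
proof (induction k)
  case 0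
  then show ?case
    using run by (simp add: run_def)
next
  case (Suc k)
  have "0 \<le> sigma P * a k * (norm (G k))\<^sup>2"
    using stepsize_pos_of_F_le_C[OF Suc] params by (simp add: valid_params_def)
  then have "F (Suc k) \<le> C k"
    using Armijo[of k] by linarith
  then have "\<eta> k * Q k * F (Suc k) \<le> \<eta> k * Q k * C k"
    using eta[of k] Q_ge_1[of k] by (intro mult_left_mono) auto
  then have "F (Suc k) * Q (Suc k) \<le> \<eta> k * Q k * C k + F (Suc k)"
    by (simp add: Q_Suc algebra_simps)
  then show ?case
    using Q_ge_1[of "Suc k"] by (simp add: C_Suc pos_le_divide_eq)
qed

section \<open>Uniform stepsize bound and weighted summability\<close>

definition stepsize_bound :: real where
  "stepsize_bound = min (lam_min P) (0.1 * (2 * (1 - sigma P) / L))"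

lemma stepsize_bound_pos: "0 < stepsize_bound"
  using params L_pos by (simp add: valid_params_def stepsize_bound_def)

text \<open>The index starts at 1 since the initial trial step is not clipped to
  \<open>lam_min P\<close>.\<close>

lemma stepsize_ge: "stepsize_bound \<le> a (Suc k)"
proof -
  have "lam_min P \<le> trial (Suc k)"
    by (simp add: trial_def)
  then show ?thesis
    using stepsize_ge_of_F_le_C[OF F_le_C, of "Suc k"] by (simp add: stepsize_bound_def)
qed

lemma summable_gradients: "summable (\<lambda>k. (norm (G (Suc k)))\<^sup>2 / Q (Suc (Suc k)))"
proof -
  obtain m where m: "\<And>z. m \<le> f z"
    using bounded_below by (auto simp: bdd_below_def)
  let ?c = "sigma P * stepsize_bound"
  have sigma: "0 < sigma P"
    using params by (simp add: valid_params_def)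
  then have c: "0 < ?c"
    using stepsize_bound_pos by simp
  have "summable (\<lambda>k. ?c * ((norm (G (Suc k)))\<^sup>2 / Q (Suc (Suc k))))"
  proof (rule summable_of_decrease[where c = "\<lambda>k. C (Suc k)" and m = m])
    fix k
    show "0 \<le> ?c * ((norm (G (Suc k)))\<^sup>2 / Q (Suc (Suc k)))"
      using c Q_ge_1[of "Suc (Suc k)"] by simp
    show "m \<le> C (Suc k)"
      using m F_le_C order_trans by blast
    have "?c * (norm (G (Suc k)))\<^sup>2 \<le> sigma P * a (Suc k) * (norm (G (Suc k)))\<^sup>2"
      using sigma stepsize_ge by (intro mult_right_mono mult_left_mono) auto
    also have "\<dots> \<le> C (Suc k) - F (Suc (Suc k))"
      using Armijo[of "Suc k"] by linarith
    \<comment> \<open>This is the recursion for \<open>C\<close> multiplied by the new weight; the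
      two weights in it differ by the factor \<open>\<eta>\<close> and the summand 1.\<close>
    also have "\<dots> = (C (Suc k) - C (Suc (Suc k))) * Q (Suc (Suc k))"
      using Q_ge_1[of "Suc (Suc k)"]
      by (simp add: C_Suc[of "Suc k"] left_diff_distrib) (simp add: Q_Suc[of "Suc k"] algebra_simps)
    finally show "?c * ((norm (G (Suc k)))\<^sup>2 / Q (Suc (Suc k))) \<le> C (Suc k) - C (Suc (Suc k))"
      using Q_ge_1[of "Suc (Suc k)"] by (simp add: pos_divide_le_eq)
  qed
  then have "?c = 0 \<or> ?thesis"
    by (rule summable_cmult_iff[THEN iffD1])
  with c show ?thesis
    by linarith
qed

section \<open>Convergence of the gradients\<close>

lemma liminf_gradient: "liminf (\<lambda>k. ereal (norm (G k))) = 0"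
proof (rule antisym)
  show "0 \<le> liminf (\<lambda>k. ereal (norm (G k)))"
    by (intro Liminf_bounded) simp
  show "liminf (\<lambda>k. ereal (norm (G k))) \<le> 0"
  proof (rule ccontr)
    assume "\<not> ?thesis"
    then have "0 < liminf (\<lambda>k. ereal (norm (G k)))"
      by simp
    then obtain e :: real where e: "0 < e" "ereal e < liminf (\<lambda>k. ereal (norm (G k)))"
      using ereal_dense2 by force
    then have "eventually (\<lambda>k. e < norm (G k)) sequentially"
      using less_LiminfD by force
    then have "eventually (\<lambda>k. e < norm (G (Suc k))) sequentially"
      by (rule eventually_sequentially_Suc[THEN iffD2])
    \<comment> \<open>The triple \<open>Suc\<close> is the linear bound on \<open>Q\<close> at index
      \<open>k + 2\<close>, namely \<open>k + 3\<close>. The summable series would then dominate a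
      shifted harmonic series.\<close>
    then have "eventually (\<lambda>k. norm (e\<^sup>2 * inverse (real (Suc (Suc (Suc k)))))
        \<le> (norm (G (Suc k)))\<^sup>2 / Q (Suc (Suc k))) sequentially"
    proof eventually_elim
      case (elim k)
      have "e\<^sup>2 / real (Suc (Suc (Suc k))) \<le> (norm (G (Suc k)))\<^sup>2 / Q (Suc (Suc k))"
        using elim e Q_le_linear[of "Suc (Suc k)"] Q_ge_1[of "Suc (Suc k)"]
        by (intro frac_le power_mono) auto
      then show ?case
        by (simp add: divide_inverse)
    qed
    then have "summable (\<lambda>k. e\<^sup>2 * inverse (real (Suc (Suc (Suc k)))))"
      by (rule summable_comparison_test_ev) (rule summable_gradients)
    then have "summable (\<lambda>k. inverse (real (Suc (Suc (Suc k)))))"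
      using e by (simp add: summable_cmult_iff del: of_nat_Suc)
    then have "summable (\<lambda>k. inverse (real k))"
      by (simp only: summable_Suc_iff[of "\<lambda>k. inverse (real (Suc (Suc k)))"]
          summable_Suc_iff[of "\<lambda>k. inverse (real (Suc k))"]
          summable_Suc_iff[of "\<lambda>k. inverse (real k)"])
    then show False
      using not_summable_harmonic[where 'a = real] by (simp add: field_simps)
  qed
qed

lemma gradient_tendsto_0:
  assumes "eta_max P < 1"
  shows "(\<lambda>k. norm (G k)) \<longlonglongrightarrow> 0"
proof -
  have "(\<lambda>k. 1 / (1 - eta_max P) * ((norm (G (Suc k)))\<^sup>2 / Q (Suc (Suc k)))) \<longlonglongrightarrow> 0"
    using tendsto_mult_right_zero[OF summable_LIMSEQ_zero[OF summable_gradients]] .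
  then have "(\<lambda>k. (norm (G (Suc k)))\<^sup>2) \<longlonglongrightarrow> 0"
  \<comment> \<open>With \<open>Q\<close> bounded, multiplying the terms of the convergent series by
    that bound majorizes the squared norms themselves.\<close>
  proof (rule tendsto_sandwich[OF _ _ tendsto_const, rotated 2])
    have "(norm (G (Suc k)))\<^sup>2 \<le> 1 / (1 - eta_max P) * ((norm (G (Suc k)))\<^sup>2 / Q (Suc (Suc k)))"
      for k
    proof -
      have "Q (Suc (Suc k)) * ((norm (G (Suc k)))\<^sup>2 / Q (Suc (Suc k)))
          \<le> 1 / (1 - eta_max P) * ((norm (G (Suc k)))\<^sup>2 / Q (Suc (Suc k)))"
        using Q_le_const[OF assms] Q_ge_1[of "Suc (Suc k)"] by (intro mult_right_mono) auto
      then show ?thesis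
        using Q_ge_1[of "Suc (Suc k)"] by simp
    qed
    then show "eventually (\<lambda>k. (norm (G (Suc k)))\<^sup>2
        \<le> 1 / (1 - eta_max P) * ((norm (G (Suc k)))\<^sup>2 / Q (Suc (Suc k)))) sequentially"
      by (intro always_eventually allI)
  qed simp
  then have "(\<lambda>k. norm (G (Suc k))) \<longlonglongrightarrow> 0"
    using tendsto_real_sqrt by fastforce
  then show ?thesis
    by (rule LIMSEQ_imp_Suc)
qed

end

theorem theorem3p1:
  fixes P :: gm_aos_params
    and f :: "real ^ 'n \<Rightarrow> real"
    and g :: "real ^ 'n \<Rightarrow> real ^ 'n"
    and L :: real
    and x :: "nat \<Rightarrow> real ^ 'n"
    and a C Q \<eta> :: "nat \<Rightarrow> real"
  assumes params: "valid_params P"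
    and gradient: "\<And>z. GDERIV f z :> g z"
    and gradient_continuous: "continuous_on UNIV g"
    and bounded_below: "bdd_below (range f)"
    and L_pos: "L > 0"
    and gradient_lipschitz: "\<And>z w. norm (g z - g w) \<le> L * norm (z - w)"
    and run: "gm_aos.run P f g x a C Q \<eta>"
    and nonstationary: "\<And>k. g (x k) \<noteq> 0"
  shows "liminf (\<lambda>k. ereal (norm (g (x k)))) = 0 \<and>
    (eta_max P < 1 \<longrightarrow>
       (\<lambda>k. norm (g (x k))) \<longlonglongrightarrow> 0 \<and>
       (\<forall>\<phi> xs. strict_mono \<phi> \<and> (x \<circ> \<phi>) \<longlonglongrightarrow> xs \<longrightarrow> g xs = 0))"
proof -
  interpret gm_aos_run P f g x a C L Q \<eta>
    using assms by unfold_locales auto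
  have "g xs = 0" if "eta_max P < 1" "strict_mono \<phi>" "(x \<circ> \<phi>) \<longlonglongrightarrow> xs" for \<phi> xs
  \<comment> \<open>The gradients along the subsequence have two limits: \<open>g xs\<close> by
    continuity, and 0 from the whole sequence.\<close>
  proof (rule LIMSEQ_unique)
    show "(\<lambda>k. g ((x \<circ> \<phi>) k)) \<longlonglongrightarrow> g xs"
      using continuous_on_tendsto_compose[OF gradient_continuous that(3)] by simp
    have "(\<lambda>k. g (x k)) \<longlonglongrightarrow> 0"
      using gradient_tendsto_0[OF that(1)] by (rule tendsto_norm_zero_cancel)
    then show "(\<lambda>k. g ((x \<circ> \<phi>) k)) \<longlonglongrightarrow> 0"
      using LIMSEQ_subseq_LIMSEQ[OF _ that(2)] by (fastforce simp: comp_def)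
  qed
  then show ?thesis
    using liminf_gradient gradient_tendsto_0 by blast
qed

end
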